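(* Every satisfiable OBFOL sentence over $\Sigma(\mathrm{Var})$ has a finite model.
   Context: Language signature $\Sigma=(\mathrm{Args},\mathrm{Rels},\mathrm{ar})$: $\mathrm{Args},\mathrm{Rels}$ finite non-empty, $\mathrm{ar}:\mathrm{Rels}\to\mathcal P(\mathrm{Args})\setminus\{\emptyset\}$. A $\Sigma$-structure $\mathcal R=(D,\cdot^{\mathcal R})$: $D$ non-empty, $r^{\mathcal R}$ a set of functions $\mathrm{ar}(r)\to D$; finite iff $D$ finite. FOL formulas over $\Sigma(\mathrm{Var})$: $\varphi::= r\mid\neg\varphi\mid\varphi\wedge\varphi\mid\varphi\vee\varphi\mid\exists x.\varphi\mid\forall x.\varphi\mid(a,x)\varphi$. Free placeholders: $\mathrm{free}(r)=\mathrm{ar}(r)$; unchanged by $\neg$; union for $\wedge,\vee$; $\mathrm{free}(Qx.\varphi)=\mathrm{free}(\varphi)\setminus\{x\}$; $\mathrm{free}((a,x)\varphi)=(\mathrm{free}(\varphi)\setminus\{a\})\cup\{x\}$ if $a\in\mathrm{free}(\varphi)$, else $\mathrm{free}(\varphi)$; a sentence has none. Semantics over partial assignments $\chi:\mathrm{Args}\cup\mathrm{Var}\rightharpoonup D$: $\mathcal R,\chi\models r$ iff $\chi|_{\mathrm{ar}(r)}\in r^{\mathcal R}$; usual Boolean/quantifier clauses; $\mathcal R,\chi\models(a,x)\varphi$ iff $\mathcal R,\chi[a\mapsto\chi(x)]\models\varphi$. A model of a sentence $\varphi$ is $\mathcal R$ with $\mathcal R,\emptyset\models\varphi$; satisfiable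 means having a model. Quantification prefix: finite word over $\{\exists x,\forall x\}$, each variable at most once; binding prefix: finite word over pairs $(a,x)$, each argument at most once; derived relation: Boolean combination ($\neg,\wedge,\vee$) of relations all having the same argument set. OBFOL formulas: $\varphi::=\wp\flat\bar r\mid(\varphi\wedge\varphi)\mid(\varphi\vee\varphi)$, $\wp$ a quantification prefix, $\flat$ a binding prefix, $\bar r$ a derived relation. *)

theory Defs
  imports Main
begin

(* The finite non-empty sets Args and Rels are rendered as types of class finite, so that
   a signature is given by its arity map alone.  Placeholders form the disjoint union of
   Args and Var. *)

definition is_signature :: "('r \<Rightarrow> 'a set) \<Rightarrow> bool" where
  "is_signature ar \<longleftrightarrow> (\<forall>r. ar r \<noteq> {})"

datatype ('a, 'v) placeholder = Arg 'a | Var 'v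

datatype ('a, 'r, 'v) form =
    Rel 'r
  | Neg "('a, 'r, 'v) form"
  | Conj "('a, 'r, 'v) form" "('a, 'r, 'v) form"
  | Disj "('a, 'r, 'v) form" "('a, 'r, 'v) form"
  | Ex 'v "('a, 'r, 'v) form"
  | All 'v "('a, 'r, 'v) form"
  | Bind 'a 'v "('a, 'r, 'v) form"

primrec free :: "('r \<Rightarrow> 'a set) \<Rightarrow> ('a, 'r, 'v) form \<Rightarrow> ('a, 'v) placeholder set" where
  "free ar (Rel r) = Arg ` ar r"
| "free ar (Neg \<phi>) = free ar \<phi>"
| "free ar (Conj \<phi> \<psi>) = free ar \<phi> \<union> free ar \<psi>"
| "free ar (Disj \<phi> \<psi>) = free ar \<phi> \<union> free ar \<psi>"
| "free ar (Ex x \<phi>) = free ar \<phi> - {Var x}"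
| "free ar (All x \<phi>) = free ar \<phi> - {Var x}"
| "free ar (Bind a x \<phi>) =
     (if Arg a \<in> free ar \<phi> then (free ar \<phi> - {Arg a}) \<union> {Var x} else free ar \<phi>)"

definition sentence :: "('r \<Rightarrow> 'a set) \<Rightarrow> ('a, 'r, 'v) form \<Rightarrow> bool" where
  "sentence ar \<phi> \<longleftrightarrow> free ar \<phi> = {}"

(* A function from ar r to the universe D is a map with domain ar r and range inside D. *)

record ('a, 'r, 'd) struct =
  universe :: "'d set"
  interp :: "'r \<Rightarrow> ('a \<rightharpoonup> 'd) set"

definition is_structure :: "('r \<Rightarrow> 'a set) \<Rightarrow> ('a, 'r, 'd) struct \<Rightarrow> bool" where
  "is_structure ar R \<longleftrightarrow> universe R \<noteq> {} \<and>
     (\<forall>r. \<forall>t \<in> interp R r. dom t = ar r \<and> ran t \<subseteq> universe R)"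

definition finite_structure :: "('a, 'r, 'd) struct \<Rightarrow> bool" where
  "finite_structure R \<longleftrightarrow> finite (universe R)"

(* In the binding clause, if x is unassigned then so is a after the update. *)

primrec sat :: "('r \<Rightarrow> 'a set) \<Rightarrow> ('a, 'r, 'd) struct \<Rightarrow> (('a, 'v) placeholder \<rightharpoonup> 'd)
    \<Rightarrow> ('a, 'r, 'v) form \<Rightarrow> bool" where
  "sat ar R \<chi> (Rel r) \<longleftrightarrow> (\<lambda>a. \<chi> (Arg a)) |` ar r \<in> interp R r"
| "sat ar R \<chi> (Neg \<phi>) \<longleftrightarrow> \<not> sat ar R \<chi> \<phi>"
| "sat ar R \<chi> (Conj \<phi> \<psi>) \<longleftrightarrow> sat ar R \<chi> \<phi> \<and> sat ar R \<chi> \<psi>"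
| "sat ar R \<chi> (Disj \<phi> \<psi>) \<longleftrightarrow> sat ar R \<chi> \<phi> \<or> sat ar R \<chi> \<psi>"
| "sat ar R \<chi> (Ex x \<phi>) \<longleftrightarrow> (\<exists>d \<in> universe R. sat ar R (\<chi>(Var x \<mapsto> d)) \<phi>)"
| "sat ar R \<chi> (All x \<phi>) \<longleftrightarrow> (\<forall>d \<in> universe R. sat ar R (\<chi>(Var x \<mapsto> d)) \<phi>)"
| "sat ar R \<chi> (Bind a x \<phi>) \<longleftrightarrow> sat ar R (\<chi>(Arg a := \<chi> (Var x))) \<phi>"

definition is_model :: "('r \<Rightarrow> 'a set) \<Rightarrow> ('a, 'r, 'd) struct \<Rightarrow> ('a, 'r, 'v) form \<Rightarrow> bool" where
  "is_model ar R \<phi> \<longleftrightarrow> is_structure ar R \<and> sat ar R Map.empty \<phi>"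

(* HOL cannot quantify existentially over types, so the type from which the elements of
   the universe are drawn is a parameter. *)

definition satisfiable :: "'d itself \<Rightarrow> ('r \<Rightarrow> 'a set) \<Rightarrow> ('a, 'r, 'v) form \<Rightarrow> bool" where
  "satisfiable (_ :: 'd itself) ar \<phi> \<longleftrightarrow> (\<exists>R :: ('a, 'r, 'd) struct. is_model ar R \<phi>)"

datatype quantifier = Exists | Forall

primrec quantify :: "quantifier \<times> 'v \<Rightarrow> ('a, 'r, 'v) form \<Rightarrow> ('a, 'r, 'v) form" where
  "quantify (q, x) \<phi> = (case q of Exists \<Rightarrow> Ex x \<phi> | Forall \<Rightarrow> All x \<phi>)"

primrec bind :: "'a \<times> 'v \<Rightarrow> ('a, 'r, 'v) form \<Rightarrow> ('a, 'r, 'v) form" where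
  "bind (a, x) \<phi> = Bind a x \<phi>"

definition is_quantification_prefix :: "(quantifier \<times> 'v) list \<Rightarrow> bool" where
  "is_quantification_prefix qs \<longleftrightarrow> distinct (map snd qs)"

definition is_binding_prefix :: "('a \<times> 'v) list \<Rightarrow> bool" where
  "is_binding_prefix bs \<longleftrightarrow> distinct (map fst bs)"

inductive boolean_combination ::
    "('r \<Rightarrow> 'a set) \<Rightarrow> 'a set \<Rightarrow> ('a, 'r, 'v) form \<Rightarrow> bool" for ar A where
  "ar r = A \<Longrightarrow> boolean_combination ar A (Rel r)"
| "boolean_combination ar A \<phi> \<Longrightarrow> boolean_combination ar A (Neg \<phi>)"
| "boolean_combination ar A \<phi> \<Longrightarrow> boolean_combination ar A \<psi> \<Longrightarrow>
     boolean_combination ar A (Conj \<phi> \<psi>)"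
| "boolean_combination ar A \<phi> \<Longrightarrow> boolean_combination ar A \<psi> \<Longrightarrow>
     boolean_combination ar A (Disj \<phi> \<psi>)"

definition derived_relation :: "('r \<Rightarrow> 'a set) \<Rightarrow> ('a, 'r, 'v) form \<Rightarrow> bool" where
  "derived_relation ar \<phi> \<longleftrightarrow> (\<exists>A. boolean_combination ar A \<phi>)"

inductive OBFOL :: "('r \<Rightarrow> 'a set) \<Rightarrow> ('a, 'r, 'v) form \<Rightarrow> bool" for ar where
  "is_quantification_prefix qs \<Longrightarrow> is_binding_prefix bs \<Longrightarrow> derived_relation ar \<rho> \<Longrightarrow>
     OBFOL ar (foldr quantify qs (foldr bind bs \<rho>))"
| "OBFOL ar \<phi> \<Longrightarrow> OBFOL ar \<psi> \<Longrightarrow> OBFOL ar (Conj \<phi> \<psi>)"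
| "OBFOL ar \<phi> \<Longrightarrow> OBFOL ar \<psi> \<Longrightarrow> OBFOL ar (Disj \<phi> \<psi>)"

end

theory Submission
  imports Defs
begin

text \<open>Since every relation of a block takes the same arguments, the truth of a block at a tuple
  depends only on that tuple. Replace the quantifiers of each block by Skolem strategies, and take a
  finite universe with choice functions \<open>f l X\<close> (one for each existential position \<open>l\<close>)
  whose values reveal \<open>l\<close> and such that the graph with edges from each \<open>x \<in> X\<close> to
  \<open>f l X\<close> has no short cycle. If several blocks reach the same tuple \<open>t\<close> through plays in this
  universe, the elements involved are acyclically ordered, so recursion along this order yields a
  map \<open>g\<close> sending all these plays simultaneously to plays following the strategies of the
  original model. Letting a relation hold at \<open>t\<close> iff it holds at the \<open>g\<close>-image of \<open>t\<close>
  in the original model satisfies every block.\<close>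

subsection \<open>Finite universes without short cycles\<close>

text \<open>Here \<open>h d i\<close> stands for the colours found \<open>i\<close> steps back from
  \<open>d\<close>, a step back leading from \<open>f l X\<close> to an element of \<open>X\<close>.
  The last clause keeps the own colour of \<open>f l X\<close> away from everything 1 to
  \<open>N\<close> steps back, which is how short cycles are excluded.\<close>

definition generic_choice ::
    "'l set \<Rightarrow> nat \<Rightarrow> nat \<Rightarrow> 'd set \<Rightarrow> ('l \<Rightarrow> 'd set \<Rightarrow> 'd) \<Rightarrow> ('d \<Rightarrow> 'l) \<Rightarrow> ('d \<Rightarrow> nat \<Rightarrow> nat set) \<Rightarrow> bool" where
  "generic_choice L k N U f lab h \<longleftrightarrow> (\<forall>l\<in>L. \<forall>X. X \<subseteq> U \<longrightarrow> card X \<le> k \<longrightarrow>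
     f l X \<in> U \<and> lab (f l X) = l \<and> h (f l X) 0 \<noteq> {} \<and>
     (\<forall>j<N. h (f l X) (Suc j) = (\<Union>x\<in>X. h x j) \<and> h (f l X) 0 \<inter> (\<Union>x\<in>X. h x j) = {}))"

text \<open>An element is a label together with, for each \<open>i \<le> N\<close>, the set of colours occurring
  \<open>i\<close> steps back in its history; its own colour is chosen fresh for that history.\<close>

lemma ex_generic_choice_labelled:
  fixes L :: "'l set"
  assumes "finite L"
  shows "\<exists>(U :: ('l \<times> (nat \<Rightarrow> nat set)) set) f lab h. finite U \<and> generic_choice L k N U f lab h"
proof -
  \<comment> \<open>At most \<open>k * k ^ j\<close> colours lie \<open>j\<close> steps back from a
    set of at most \<open>k\<close> elements. One colour more than the total of these bounds always
    leaves a fresh one.\<close>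
  define M where "M = Suc (\<Sum>j<N. k * k ^ j)"
  \<comment> \<open>The bound \<open>k ^ i\<close> reproduces itself: a union of at most
    \<open>k\<close> sets of size \<open>k ^ i\<close> is an admissible entry at
    \<open>i + 1\<close>. Cutting histories off after \<open>N\<close> keeps \<open>H\<close>
    finite.\<close>
  define H where "H = {h :: nat \<Rightarrow> nat set. \<forall>i. if i \<le> N then h i \<subseteq> {..<M} \<and> card (h i) \<le> k ^ i else h i = {}}"
  define past :: "('l \<times> (nat \<Rightarrow> nat set)) set \<Rightarrow> nat \<Rightarrow> nat set"
    where "past X j = (\<Union>x\<in>X. snd x j)" for X j
  define fresh where "fresh X = (SOME c. c < M \<and> (\<forall>j<N. c \<notin> past X j))" for X
  define f where "f l X = (l :: 'l, \<lambda>i. case i of 0 \<Rightarrow> {fresh X} | Suc j \<Rightarrow> if j < N then past X j else {})" for l X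
  define U where "U = L \<times> H"
  have "H \<subseteq> {h. \<forall>i. (i \<in> {..N} \<longrightarrow> h i \<in> Pow {..<M}) \<and> (i \<notin> {..N} \<longrightarrow> h i = {})}"
    by (auto simp: H_def split: if_splits)
  then have "finite H"
    by (rule finite_subset) (rule finite_set_of_finite_funs; simp)
  then have "finite U"
    using assms by (simp add: U_def)
  have past: "card (past X j) \<le> k * k ^ j \<and> past X j \<subseteq> {..<M}"
    if X: "X \<subseteq> U" "card X \<le> k" and "j < N" for X j
  proof
    have h: "snd x \<in> H" if "x \<in> X" for x
      using X that by (auto simp: U_def)
    have "finite X"
      using X \<open>finite U\<close> finite_subset by blast
    have "card (past X j) \<le> (\<Sum>x\<in>X. card (snd x j))"
      unfolding past_def by (rule card_UN_le) fact
    also have "\<dots> \<le> (\<Sum>x\<in>X. k ^ j)"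
      using h \<open>j < N\<close> by (intro sum_mono) (auto simp: H_def split: if_splits)
    also have "\<dots> \<le> k * k ^ j"
      using X by simp
    finally show "card (past X j) \<le> k * k ^ j" .
    show "past X j \<subseteq> {..<M}"
      using h \<open>j < N\<close> unfolding past_def H_def by (fastforce split: if_splits)
  qed
  have fresh: "fresh X < M \<and> (\<forall>j<N. fresh X \<notin> past X j)"
    if X: "X \<subseteq> U" "card X \<le> k" for X
  proof -
    have "card (\<Union>j<N. past X j) \<le> (\<Sum>j<N. card (past X j))"
      by (rule card_UN_le) simp
    also have "\<dots> \<le> (\<Sum>j<N. k * k ^ j)"
      using past[OF X] by (intro sum_mono) auto
    also have "\<dots> < card {..<M}"
      by (simp add: M_def)
    finally have "\<not> {..<M} \<subseteq> (\<Union>j<N. past X j)"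
      using past[OF X] finite_subset[of _ "{..<M}"] by (metis (no_types, lifting) card_mono finite_UN finite_lessThan lessThan_iff linorder_not_less)
    then have "\<exists>c. c < M \<and> (\<forall>j<N. c \<notin> past X j)"
      by blast
    then show ?thesis
      unfolding fresh_def by (rule someI_ex)
  qed
  have "generic_choice L k N U f fst snd"
    unfolding generic_choice_def
  proof (intro ballI allI impI)
    fix l X
    assume l: "l \<in> L" and X: "X \<subseteq> U" "card X \<le> k"
    have "snd (f l X) \<in> H"
      unfolding H_def mem_Collect_eq
    proof
      fix i
      show "if i \<le> N then snd (f l X) i \<subseteq> {..<M} \<and> card (snd (f l X) i) \<le> k ^ i
        else snd (f l X) i = {}"
        using past[OF X] fresh[OF X] by (cases i) (auto simp: f_def)
    qed
    then show "f l X \<in> U \<and> fst (f l X) = l \<and> snd (f l X) 0 \<noteq> {} \<and>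
      (\<forall>j<N. snd (f l X) (Suc j) = (\<Union>x\<in>X. snd x j) \<and> snd (f l X) 0 \<inter> (\<Union>x\<in>X. snd x j) = {})"
      using l fresh[OF X] by (auto simp: U_def f_def past_def)
  qed
  then show ?thesis
    using \<open>finite U\<close> by blast
qed

text \<open>Moves the universe into \<open>nat\<close>, the element type of the final model. Labels
  and histories are pulled back along an enumeration \<open>e\<close>, and \<open>f'\<close> picks a
  preimage of each chosen value.\<close>

lemma ex_generic_choice_nat:
  assumes "finite L"
  shows "\<exists>(U :: nat set) f lab h. finite U \<and> generic_choice L k N U f lab h"
proof -
  obtain U :: "('a \<times> (nat \<Rightarrow> nat set)) set" and f lab h
    where U: "finite U" "generic_choice L k N U f lab h"
    using ex_generic_choice_labelled[OF assms] by blast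
  obtain n and e :: "nat \<Rightarrow> _" where e: "U = e ` {i. i < n}"
    using finite_imp_nat_seg_image_inj_on[OF U(1)] by blast
  define f' where "f' l X = (SOME m. m < n \<and> e m = f l (e ` X))" for l X
  have "generic_choice L k N {i. i < n} f' (lab \<circ> e) (h \<circ> e)"
    unfolding generic_choice_def
  proof (intro ballI allI impI)
    fix l X
    assume l: "l \<in> L" and X: "X \<subseteq> {i. i < n}" "card X \<le> k"
    have "finite X"
      using X finite_subset by fastforce
    then have "card (e ` X) \<le> k"
      using X card_image_le le_trans by blast
    moreover have "e ` X \<subseteq> U"
      using X e by blast
    ultimately have g: "f l (e ` X) \<in> U \<and> lab (f l (e ` X)) = l \<and> h (f l (e ` X)) 0 \<noteq> {} \<and>
      (\<forall>j<N. h (f l (e ` X)) (Suc j) = (\<Union>x\<in>e ` X. h x j) \<and>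
        h (f l (e ` X)) 0 \<inter> (\<Union>x\<in>e ` X. h x j) = {})"
      using U(2)[unfolded generic_choice_def, rule_format, OF l, of "e ` X"] by simp
    then have "f l (e ` X) \<in> e ` {i. i < n}"
      using e by simp
    then have "\<exists>m. m < n \<and> e m = f l (e ` X)"
      by (metis imageE mem_Collect_eq)
    then have "f' l X < n \<and> e (f' l X) = f l (e ` X)"
      unfolding f'_def by (rule someI_ex)
    with g show "f' l X \<in> {i. i < n} \<and> (lab \<circ> e) (f' l X) = l \<and> (h \<circ> e) (f' l X) 0 \<noteq> {} \<and>
      (\<forall>j<N. (h \<circ> e) (f' l X) (Suc j) = (\<Union>x\<in>X. (h \<circ> e) x j) \<and>
        (h \<circ> e) (f' l X) 0 \<inter> (\<Union>x\<in>X. (h \<circ> e) x j) = {})"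
      by simp
  qed
  then show ?thesis
    by (metis finite_Collect_less_nat)
qed

text \<open>Each edge pushes colours one step further back. Going once round a cycle of length at
  most \<open>N\<close> would therefore put the own colour of an element into its own history,
  against freshness.\<close>

lemma generic_choice_acyclic:
  assumes gen: "generic_choice L k N U f lab h"
    and r: "finite r" "card r \<le> N"
    and edge: "\<And>x y. (x, y) \<in> r \<Longrightarrow> \<exists>l\<in>L. \<exists>X\<subseteq>U. card X \<le> k \<and> x \<in> X \<and> y = f l X"
  shows "acyclic r"
proof -
  have step: "h x n \<subseteq> h y (Suc n) \<and> h y 0 \<noteq> {} \<and> h y 0 \<inter> h y (Suc n) = {}"
    if "(x, y) \<in> r" "n < N" for x y n
    using edge[OF that(1)] gen that(2) unfolding generic_choice_def by blast
  have path: "h x 0 \<subseteq> h y n" if "(x, y) \<in> r ^^ n" "n \<le> N" for x y n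
    using that
  proof (induction n arbitrary: y)
    case (Suc n)
    then obtain z where "(x, z) \<in> r ^^ n" "(z, y) \<in> r"
      by auto
    then show ?case
      using Suc step[of z y n] by fastforce
  qed simp
  show ?thesis
  proof (rule acyclicI, intro allI notI)
    fix x
    assume "(x, x) \<in> r\<^sup>+"
    \<comment> \<open>In a finite relation a cycle can be shortened to at most \<open>card r\<close>
      edges, hence to a length that the histories still control.\<close>
    then obtain n where "0 < n" "n \<le> card r" "(x, x) \<in> r ^^ n"
      unfolding trancl_finite_eq_relpow[OF r(1)] by auto
    then obtain m where m: "m < N" "(x, x) \<in> r ^^ Suc m"
      using r(2) by (metis Suc_le_lessD gr0_implies_Suc le_trans)
    then obtain z where "(z, x) \<in> r"
      by auto
    then show False
      using step[of z x m] path[of x x "Suc m"] m by auto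
  qed
qed

subsection \<open>Strategies\<close>

text \<open>A strategy computes each existential value from the list of all values chosen before.\<close>

definition play :: "'d set \<Rightarrow> ('d list \<Rightarrow> 'd) \<Rightarrow> (quantifier \<times> 'v) list \<Rightarrow> 'd list \<Rightarrow> bool" where
  "play U \<sigma> qs vs \<longleftrightarrow> length vs = length qs \<and> set vs \<subseteq> U \<and>
     (\<forall>j<length qs. fst (qs ! j) = Exists \<longrightarrow> vs ! j = \<sigma> (take j vs))"

lemma play_Nil [simp]: "play U \<sigma> [] vs \<longleftrightarrow> vs = []"
  by (auto simp: play_def)

lemma play_Cons:
  "play U \<sigma> (q # qs) (d # vs) \<longleftrightarrow>
     d \<in> U \<and> (fst q = Exists \<longrightarrow> d = \<sigma> []) \<and> play U (\<lambda>h. \<sigma> (d # h)) qs vs"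
  by (simp add: play_def All_less_Suc2) blast

lemma play_ConsE:
  assumes "play U \<sigma> (q # qs) vs"
  obtains d ws where "vs = d # ws" "d \<in> U" "fst q = Exists \<longrightarrow> d = \<sigma> []"
    "play U (\<lambda>h. \<sigma> (d # h)) qs ws"
proof -
  obtain d ws where vs: "vs = d # ws"
    using assms by (cases vs) (simp_all add: play_def)
  show thesis
    using assms unfolding vs play_Cons by (intro that[OF vs]) simp_all
qed

text \<open>Skolemization, by induction on the prefix: the strategy for the remaining quantifiers is
  chosen separately for each first value. Its values lie in the universe even on histories that no
  play produces, so it can later serve as a total rule in a recursion.\<close>

lemma sat_quantify_strategy:
  assumes "sat ar R \<chi> (foldr quantify qs \<psi>)" and "universe R \<noteq> {}"
  shows "\<exists>\<sigma>. (\<forall>w. \<sigma> w \<in> universe R) \<and>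
    (\<forall>vs. play (universe R) \<sigma> qs vs \<longrightarrow> sat ar R (\<chi>(map (\<lambda>q. Var (snd q)) qs [\<mapsto>] vs)) \<psi>)"
  using assms(1)
proof (induction qs arbitrary: \<chi>)
  case Nil
  then show ?case
    using assms(2) by auto
next
  case (Cons qx qs)
  obtain q x where qx: "qx = (q, x)"
    by fastforce
  \<comment> \<open>For an existential quantifier \<open>d0\<close> is the witness; for a universal
    one it is an arbitrary element, serving as a default value.\<close>
  obtain d0 where d0: "d0 \<in> universe R"
    and sat: "\<And>d. d \<in> universe R \<Longrightarrow> (q = Exists \<longrightarrow> d = d0) \<Longrightarrow>
      sat ar R (\<chi>(Var x \<mapsto> d)) (foldr quantify qs \<psi>)"
    using Cons.prems assms(2) qx by (cases q) auto
  \<comment> \<open>Stated for every \<open>d\<close>, legal as a first value or not, so that choice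
    gives a total family \<open>\<tau>\<close>; illegal values get a constant strategy.\<close>
  have "\<exists>\<sigma>. (\<forall>w. \<sigma> w \<in> universe R) \<and> (d \<in> universe R \<longrightarrow> (q = Exists \<longrightarrow> d = d0) \<longrightarrow>
    (\<forall>vs. play (universe R) \<sigma> qs vs \<longrightarrow>
      sat ar R (\<chi>(Var x \<mapsto> d, map (\<lambda>q. Var (snd q)) qs [\<mapsto>] vs)) \<psi>))" for d
  proof (cases "d \<in> universe R \<and> (q = Exists \<longrightarrow> d = d0)")
    case True
    then show ?thesis
      using Cons.IH[OF sat[of d]] by blast
  next
    case False
    then show ?thesis
      using d0 by (intro exI[of _ "\<lambda>_. d0"]) simp
  qed
  then obtain \<tau> where \<tau>: "\<And>d w. \<tau> d w \<in> universe R"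
    "\<And>d vs. d \<in> universe R \<Longrightarrow> (q = Exists \<longrightarrow> d = d0) \<Longrightarrow> play (universe R) (\<tau> d) qs vs \<Longrightarrow>
      sat ar R (\<chi>(Var x \<mapsto> d, map (\<lambda>q. Var (snd q)) qs [\<mapsto>] vs)) \<psi>"
    by metis
  define \<sigma> where "\<sigma> w = (case w of [] \<Rightarrow> d0 | d # w' \<Rightarrow> \<tau> d w')" for w
  have "\<forall>w. \<sigma> w \<in> universe R"
    using \<tau>(1) d0 by (auto simp: \<sigma>_def split: list.split)
  moreover have "sat ar R (\<chi>(map (\<lambda>q. Var (snd q)) (qx # qs) [\<mapsto>] vs)) \<psi>"
    if "play (universe R) \<sigma> (qx # qs) vs" for vs
    using that \<tau>(2) by (auto elim!: play_ConsE simp: qx \<sigma>_def)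
  ultimately show ?case
    by blast
qed

text \<open>The converse, for the finite structure. Values need to lie in the universe only after
  histories that stay inside it and are shorter than the prefix, because generic choices are
  controlled only on small subsets.\<close>

lemma strategy_sat_quantify:
  assumes "\<And>vs. play (universe R) \<sigma> qs vs \<Longrightarrow> sat ar R (\<chi>(map (\<lambda>q. Var (snd q)) qs [\<mapsto>] vs)) \<psi>"
    and "\<And>w. set w \<subseteq> universe R \<Longrightarrow> length w < length qs \<Longrightarrow> \<sigma> w \<in> universe R"
  shows "sat ar R \<chi> (foldr quantify qs \<psi>)"
  using assms
proof (induction qs arbitrary: \<chi> \<sigma>)
  case (Cons qx qs)
  obtain q x where qx: "qx = (q, x)"
    by fastforce
  have *: "sat ar R (\<chi>(Var x \<mapsto> d)) (foldr quantify qs \<psi>)"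
    if "d \<in> universe R" "q = Exists \<longrightarrow> d = \<sigma> []" for d
  proof (rule Cons.IH[of "\<lambda>w. \<sigma> (d # w)"])
    show "sat ar R (\<chi>(Var x \<mapsto> d, map (\<lambda>q. Var (snd q)) qs [\<mapsto>] vs)) \<psi>"
      if "play (universe R) (\<lambda>w. \<sigma> (d # w)) qs vs" for vs
      using Cons.prems(1)[of "d # vs"] that \<open>d \<in> universe R\<close> \<open>q = Exists \<longrightarrow> d = \<sigma> []\<close>
      by (simp add: play_Cons qx)
  qed (use Cons.prems(2) that in simp)
  have "\<sigma> [] \<in> universe R"
    using Cons.prems(2)[of "[]"] by simp
  then show ?case
    using * by (cases q) (auto simp: qx)
qed simp

subsection \<open>Blocks\<close>

text \<open>The outermost binding is the head of the list and updates the assignment first, hence a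
  left fold although the formula is built with \<open>foldr\<close>.\<close>

definition rebind :: "('a \<times> 'v) list \<Rightarrow> (('a, 'v) placeholder \<rightharpoonup> 'd) \<Rightarrow> ('a, 'v) placeholder \<rightharpoonup> 'd" where
  "rebind bs \<chi> = fold (\<lambda>(a, x) \<chi>. \<chi>(Arg a := \<chi> (Var x))) bs \<chi>"

lemma rebind_Nil [simp]: "rebind [] \<chi> = \<chi>"
  by (simp add: rebind_def)

lemma rebind_Cons [simp]: "rebind ((a, x) # bs) \<chi> = rebind bs (\<chi>(Arg a := \<chi> (Var x)))"
  by (simp add: rebind_def)

lemma sat_foldr_bind: "sat ar R \<chi> (foldr bind bs \<rho>) \<longleftrightarrow> sat ar R (rebind bs \<chi>) \<rho>"
proof (induction bs arbitrary: \<chi>)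
  case (Cons b bs)
  then show ?case
    by (cases b) (simp add: fun_upd_def)
qed simp

lemma rebind_map_option: "rebind bs (map_option g \<circ> \<chi>) = map_option g \<circ> rebind bs \<chi>"
proof (induction bs arbitrary: \<chi>)
  case (Cons b bs)
  obtain a x where b: "b = (a, x)"
    by fastforce
  have "(map_option g \<circ> \<chi>)(Arg a := (map_option g \<circ> \<chi>) (Var x)) =
    map_option g \<circ> \<chi>(Arg a := \<chi> (Var x))"
    by auto
  then show ?case
    unfolding b rebind_Cons using Cons by metis
qed simp

lemma map_option_map_upds:
  "map_option g \<circ> \<chi>(xs [\<mapsto>] vs) = (map_option g \<circ> \<chi>)(xs [\<mapsto>] map g vs)"
proof (induction xs arbitrary: \<chi> vs)
  case (Cons x xs)
  have "map_option g \<circ> \<chi>(x \<mapsto> v) = (map_option g \<circ> \<chi>)(x \<mapsto> g v)" for v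
    by auto
  then show ?case
    using Cons by (cases vs) (simp_all only: map_upds_Cons map_upds_Nil2 list.map)
qed simp

text \<open>The one tuple at which all relations of a block with argument set \<open>A\<close> are
  evaluated after the values \<open>vs\<close> have been played.\<close>

definition tuple :: "'a set \<Rightarrow> (quantifier \<times> 'v) list \<Rightarrow> ('a \<times> 'v) list \<Rightarrow> 'd list \<Rightarrow> 'a \<rightharpoonup> 'd" where
  "tuple A qs bs vs = (\<lambda>a. rebind bs [map (\<lambda>q. Var (snd q)) qs [\<mapsto>] vs] (Arg a)) |` A"

text \<open>Quantifiers and bindings only copy values, so forming the tuple commutes with every map
  of elements.\<close>

lemma tuple_map: "tuple A qs bs (map g vs) = map_option g \<circ> tuple A qs bs vs"
proof -
  have "[map (\<lambda>q. Var (snd q)) qs [\<mapsto>] map g vs] =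
    map_option g \<circ> ([map (\<lambda>q. Var (snd q)) qs [\<mapsto>] vs] :: ('a, 'c) placeholder \<rightharpoonup> 'd)"
    unfolding map_option_map_upds by (simp add: comp_def)
  then show ?thesis
    by (auto simp: tuple_def rebind_map_option restrict_map_def)
qed

text \<open>The one-binding restriction enters here: all relations share the argument set
  \<open>A\<close>, so they inspect the same restricted tuple, and agreement there passes through
  the connectives. The two structures may have different element types.\<close>

lemma boolean_combination_cong:
  assumes "boolean_combination ar A \<rho>"
    and "\<And>r. ar r = A \<Longrightarrow>
      (\<lambda>a. \<chi> (Arg a)) |` A \<in> interp R r \<longleftrightarrow> (\<lambda>a. \<chi>' (Arg a)) |` A \<in> interp R' r"
  shows "sat ar R \<chi> \<rho> \<longleftrightarrow> sat ar R' \<chi>' \<rho>"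
  using assms by (induction rule: boolean_combination.induct) auto

lemma ran_map_upds_subset: "ran (\<chi>(xs [\<mapsto>] vs)) \<subseteq> ran \<chi> \<union> set vs"
proof (induction xs arbitrary: \<chi> vs)
  case (Cons x xs)
  have ran_upd: "ran (\<chi>(x \<mapsto> v)) \<subseteq> insert v (ran \<chi>)" for v
    by (auto simp: ran_def)
  show ?case
  proof (cases vs)
    case (Cons v ws)
    then show ?thesis
      using Cons.IH[of "\<chi>(x \<mapsto> v)" ws] ran_upd[of v] by (simp only: map_upds_Cons list.set) blast
  qed simp
qed simp

lemma ran_rebind_subset: "ran (rebind bs \<chi>) \<subseteq> ran \<chi>"
proof (induction bs arbitrary: \<chi>)
  case (Cons b bs)
  then show ?case
    by (fastforce simp: rebind_def ran_def split: if_splits prod.splits)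
qed (simp add: rebind_def)

lemma ran_tuple_subset: "ran (tuple A qs bs vs) \<subseteq> set vs"
proof -
  have "ran (tuple A qs bs vs) \<subseteq> ran (rebind bs [map (\<lambda>q. Var (snd q)) qs [\<mapsto>] vs])"
    by (auto simp: tuple_def ran_def restrict_map_def split: if_splits)
  also have "\<dots> \<subseteq> set vs"
    using ran_rebind_subset ran_map_upds_subset[of Map.empty] by fastforce
  finally show ?thesis .
qed

section \<open>Simultaneous transfer of plays\<close>

text \<open>The image of an existential value is dictated by the images of the values before it in
  its play. Labels prevent two plays or positions from dictating images for the same element, and
  acyclicity makes these demands solvable by one recursion for all plays.\<close>

lemma generic_plays_transfer:
  fixes D :: "'d set" and U :: "'u set" and qs :: "'i \<Rightarrow> (quantifier \<times> 'v) list"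
  assumes "finite I" and "J \<subseteq> I"
    and K: "K = (\<Sum>i\<in>I. length (qs i))"
    and gen: "generic_choice (I \<times> {..K}) K (K * K) U f lab h"
    and plays: "\<And>i. i \<in> J \<Longrightarrow> play U (\<lambda>w. f (i, length w) (set w)) (qs i) (vs i)"
    and \<sigma>: "\<And>i w. i \<in> I \<Longrightarrow> \<sigma> i w \<in> D" and "D \<noteq> {}"
  shows "\<exists>g. \<forall>i\<in>J. play D (\<sigma> i) (qs i) (map g (vs i))"
proof -
  obtain d0 where d0: "d0 \<in> D"
    using \<open>D \<noteq> {}\<close> by blast
  define V where "V = (\<Union>i\<in>J. set (vs i))"
  \<comment> \<open>Edges record dependency: the image of \<open>y\<close> is computed from the
    images of all \<open>x\<close> played before it.\<close>
  define r where "r = {(x, y). \<exists>i\<in>J. \<exists>j<length (qs i).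
    fst (qs i ! j) = Exists \<and> x \<in> set (take j (vs i)) \<and> y = vs i ! j}"
  have "finite J"
    using assms finite_subset by blast
  have len: "length (vs i) = length (qs i)" if "i \<in> J" for i
    using plays[OF that] by (simp add: play_def)
  have lenK: "length (qs i) \<le> K" if "i \<in> J" for i
    unfolding K using that assms by (intro member_le_sum) auto
  have sel: "vs i ! j = f (i, j) (set (take j (vs i))) \<and> set (take j (vs i)) \<subseteq> U \<and>
      card (set (take j (vs i))) \<le> K \<and> (i, j) \<in> I \<times> {..K}"
    if "i \<in> J" "j < length (qs i)" "fst (qs i ! j) = Exists" for i j
  proof -
    have "card (set (take j (vs i))) \<le> j"
      by (rule order_trans[OF card_length]) simp
    moreover have "set (take j (vs i)) \<subseteq> U"
      using plays[OF that(1)] set_take_subset[of j "vs i"] unfolding play_def by blast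
    ultimately show ?thesis
      using plays[OF that(1)] that lenK[OF that(1)] len[OF that(1)] \<open>J \<subseteq> I\<close>
      by (auto simp: play_def min_def)
  qed
  \<comment> \<open>An element thus identifies the only play and the only existential position at
    which it can have been chosen.\<close>
  have lab: "lab (vs i ! j) = (i, j)"
    if "i \<in> J" "j < length (qs i)" "fst (qs i ! j) = Exists" for i j
    using sel[OF that] gen unfolding generic_choice_def by metis
  have "finite V"
    using \<open>finite J\<close> by (simp add: V_def)
  have "card V \<le> (\<Sum>i\<in>J. card (set (vs i)))"
    unfolding V_def by (rule card_UN_le) fact
  also have "\<dots> \<le> (\<Sum>i\<in>J. length (qs i))"
    using len by (intro sum_mono) (metis card_length)
  also have "\<dots> \<le> K"
    unfolding K using assms by (intro sum_mono2) auto
  \<comment> \<open>All plays together use at most \<open>K\<close> elements, so \<open>r\<close>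
    has at most \<open>K * K\<close> edges; this is why the universe excludes cycles up to that
    length.\<close>
  finally have "card (V \<times> V) \<le> K * K"
    by (simp add: card_cartesian_product mult_le_mono)
  moreover have "r \<subseteq> V \<times> V"
  proof (rule subrelI)
    fix x y
    assume "(x, y) \<in> r"
    then obtain i j where ij: "i \<in> J" "j < length (qs i)" "x \<in> set (take j (vs i))" "y = vs i ! j"
      unfolding r_def by blast
    then have "x \<in> set (vs i)" "y \<in> set (vs i)"
      using len[OF ij(1)] by (meson in_set_takeD, metis nth_mem)
    then show "(x, y) \<in> V \<times> V"
      using ij(1) unfolding V_def by blast
  qed
  moreover have "finite (V \<times> V)"
    using \<open>finite V\<close> by simp
  ultimately have "card r \<le> K * K" "finite r"
    by (meson card_mono finite_subset le_trans)+
  then have "acyclic r"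
  proof (intro generic_choice_acyclic[OF gen])
    fix x y
    assume "(x, y) \<in> r"
    then obtain i j where "i \<in> J" "j < length (qs i)" "fst (qs i ! j) = Exists"
      "x \<in> set (take j (vs i))" "y = vs i ! j"
      by (auto simp: r_def)
    then show "\<exists>l\<in>I \<times> {..K}. \<exists>X\<subseteq>U. card X \<le> K \<and> x \<in> X \<and> y = f l X"
      using sel by blast
  qed auto
  then have "wf r"
    using \<open>finite r\<close> finite_acyclic_wf by blast
  \<comment> \<open>The label of \<open>y\<close> selects the rule that applies to it. Elements not
    chosen at an existential position of these plays are unconstrained and go to \<open>d0\<close>.
    Only images of predecessors of \<open>y\<close> under \<open>r\<close> are read.\<close>
  define H where "H g y = (case lab y of (i, j) \<Rightarrow>
    if i \<in> J \<and> j < length (qs i) \<and> fst (qs i ! j) = Exists \<and> y = vs i ! j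
    then \<sigma> i (map g (take j (vs i))) else d0)" for g y
  have "adm_wf r H"
    unfolding adm_wf_def
  proof (intro allI impI)
    fix g g' :: "'u \<Rightarrow> 'd" and y
    assume eq: "\<forall>z. (z, y) \<in> r \<longrightarrow> g z = g' z"
    obtain i j where ij: "lab y = (i, j)"
      by fastforce
    have "map g (take j (vs i)) = map g' (take j (vs i))"
      if "i \<in> J" "j < length (qs i)" "fst (qs i ! j) = Exists" "y = vs i ! j"
      using eq that unfolding r_def by (intro map_cong) auto
    then show "H g y = H g' y"
      unfolding H_def ij case_prod_conv by (simp del: map_eq_conv cong: if_cong)
  qed
  define g where "g = wfrec r H"
  have g: "g y = H g y" for y
    unfolding g_def using wfrec_fixpoint[OF \<open>wf r\<close> \<open>adm_wf r H\<close>] by metis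
  have "H g y \<in> D" for y
    unfolding H_def using \<sigma> d0 \<open>J \<subseteq> I\<close> by (auto split: prod.split)
  then have range: "range g \<subseteq> D"
    using g by (metis image_subsetI)
  have "play D (\<sigma> i) (qs i) (map g (vs i))" if "i \<in> J" for i
    unfolding play_def
  proof (intro conjI allI impI)
    show "set (map g (vs i)) \<subseteq> D"
      using range by auto
    fix j
    assume j: "j < length (qs i)" "fst (qs i ! j) = Exists"
    then show "map g (vs i) ! j = \<sigma> i (take j (map g (vs i)))"
      using g[of "vs i ! j"] that len[OF that] lab[OF that j] by (simp add: H_def take_map)
  qed (use len that in simp)
  then show ?thesis
    by blast
qed

section \<open>The finite model\<close>

lemma finite_model_of_blocks:
  fixes ar :: "'r \<Rightarrow> 'a set" and qs :: "'i \<Rightarrow> (quantifier \<times> 'v) list"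
    and R :: "('a, 'r, 'd) struct"
  assumes I: "finite I" "I \<noteq> {}"
    and \<rho>: "\<And>i. i \<in> I \<Longrightarrow> boolean_combination ar (A i) (\<rho> i)"
    and R: "is_structure ar R"
    and sat: "\<And>i. i \<in> I \<Longrightarrow> sat ar R Map.empty (foldr quantify (qs i) (foldr bind (bs i) (\<rho> i)))"
  shows "\<exists>R' :: ('a, 'r, nat) struct. finite_structure R' \<and> is_structure ar R' \<and>
    (\<forall>i\<in>I. sat ar R' Map.empty (foldr quantify (qs i) (foldr bind (bs i) (\<rho> i))))"
proof -
  define K where "K = (\<Sum>i\<in>I. length (qs i))"
  have "universe R \<noteq> {}"
    using R by (simp add: is_structure_def)
  then have "\<forall>i\<in>I. \<exists>\<sigma>. (\<forall>w. \<sigma> w \<in> universe R) \<and>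
    (\<forall>vs. play (universe R) \<sigma> (qs i) vs \<longrightarrow>
      sat ar R [map (\<lambda>q. Var (snd q)) (qs i) [\<mapsto>] vs] (foldr bind (bs i) (\<rho> i)))"
    using sat_quantify_strategy[OF sat] by blast
  then obtain \<sigma> where \<sigma>: "\<And>i w. i \<in> I \<Longrightarrow> \<sigma> i w \<in> universe R"
    "\<And>i vs. i \<in> I \<Longrightarrow> play (universe R) (\<sigma> i) (qs i) vs \<Longrightarrow>
      sat ar R [map (\<lambda>q. Var (snd q)) (qs i) [\<mapsto>] vs] (foldr bind (bs i) (\<rho> i))"
    by metis
  obtain U :: "nat set" and f lab h
    where U: "finite U" and gen: "generic_choice (I \<times> {..K}) K (K * K) U f lab h"
    using ex_generic_choice_nat[of "I \<times> {..K}"] I(1) by (metis finite_SigmaI finite_atMost)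
  have fU: "f (i, j) X \<in> U" if "i \<in> I" "j \<le> K" "X \<subseteq> U" "card X \<le> K" for i j X
    using gen that unfolding generic_choice_def by auto
  \<comment> \<open>Some label exists because \<open>I\<close> is non-empty, and its choice for the
    empty set is an element.\<close>
  have "U \<noteq> {}"
    using fU[of _ 0 "{}"] I by auto
  \<comment> \<open>The label records the block and the position, which is the number of values
    already played.\<close>
  define \<tau> where "\<tau> i w = f (i, length w) (set w)" for i and w :: "nat list"
  let ?t = "\<lambda>i. tuple (A i) (qs i) (bs i)"
  \<comment> \<open>For a fixed tuple \<open>t\<close>, one \<open>g\<close> must serve all blocks
    reaching \<open>t\<close>, since they share the relations there. One representative play per
    block is enough: other plays of that block reaching \<open>t\<close> have the same truth
    value.\<close>
  have "\<exists>g. \<forall>i\<in>I. (\<exists>vs. play U (\<tau> i) (qs i) vs \<and> ?t i vs = t) \<longrightarrow>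
      (\<exists>vs. ?t i vs = t \<and> play (universe R) (\<sigma> i) (qs i) (map g vs))" for t
  proof -
    define J where "J = {i\<in>I. \<exists>vs. play U (\<tau> i) (qs i) vs \<and> ?t i vs = t}"
    then have "\<forall>i\<in>J. \<exists>vs. play U (\<tau> i) (qs i) vs \<and> ?t i vs = t"
      by blast
    then obtain vs where vs: "\<And>i. i \<in> J \<Longrightarrow> play U (\<tau> i) (qs i) (vs i) \<and> ?t i (vs i) = t"
      by metis
    have "\<exists>g. \<forall>i\<in>J. play (universe R) (\<sigma> i) (qs i) (map g (vs i))"
      using vs \<sigma>(1) I \<open>universe R \<noteq> {}\<close> unfolding \<tau>_def
      by (intro generic_plays_transfer[OF _ _ K_def gen]) (auto simp: J_def)
    then obtain g where g: "\<And>i. i \<in> J \<Longrightarrow> play (universe R) (\<sigma> i) (qs i) (map g (vs i))"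
      by blast
    have "\<exists>vs. ?t i vs = t \<and> play (universe R) (\<sigma> i) (qs i) (map g vs)" if "i \<in> J" for i
      using vs[OF that] g[OF that] by blast
    then show ?thesis
      unfolding J_def by blast
  qed
  then have "\<forall>t. \<exists>g. \<forall>i\<in>I. (\<exists>vs. play U (\<tau> i) (qs i) vs \<and> ?t i vs = t) \<longrightarrow>
      (\<exists>vs. ?t i vs = t \<and> play (universe R) (\<sigma> i) (qs i) (map g vs))"
    by blast
  from choice[OF this] obtain g where g: "\<And>t i vs. i \<in> I \<Longrightarrow> play U (\<tau> i) (qs i) vs \<Longrightarrow> ?t i vs = t \<Longrightarrow>
      \<exists>vs. ?t i vs = t \<and> play (universe R) (\<sigma> i) (qs i) (map (g t) vs)"
    by blast
  \<comment> \<open>A tuple is judged by its own map \<open>g t\<close>; different tuples may use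
    unrelated maps.\<close>
  define R' :: "('a, 'r, nat) struct" where "R' = \<lparr>universe = U,
    interp = \<lambda>r. {t. dom t = ar r \<and> ran t \<subseteq> U \<and> map_option (g t) \<circ> t \<in> interp R r}\<rparr>"
  have domR: "dom t = ar r" if "t \<in> interp R r" for t r
    using R that by (simp add: is_structure_def)
  have "sat ar R' Map.empty (foldr quantify (qs i) (foldr bind (bs i) (\<rho> i)))" if i: "i \<in> I" for i
  proof (rule strategy_sat_quantify[of _ "\<tau> i"])
    fix w
    assume w: "set w \<subseteq> universe R'" "length w < length (qs i)"
    have "length (qs i) \<le> K"
      unfolding K_def using i I by (intro member_le_sum) auto
    then show "\<tau> i w \<in> universe R'"
      unfolding \<tau>_def using w card_length[of w] i fU[of i "length w" "set w"] by (simp add: R'_def)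
  next
    fix vs
    assume "play (universe R') (\<tau> i) (qs i) vs"
    then have play: "play U (\<tau> i) (qs i) vs"
      by (simp add: R'_def)
    define t where "t = ?t i vs"
    \<comment> \<open>The representative \<open>ws\<close> may differ from \<open>vs\<close>, but it
      yields the same tuple, and its image follows the original strategy.\<close>
    obtain ws where ws: "?t i ws = t" "play (universe R) (\<sigma> i) (qs i) (map (g t) ws)"
      using g[OF i play t_def[symmetric]] by blast
    have "ran t \<subseteq> U"
      using ran_tuple_subset[of "A i" "qs i" "bs i" vs] play unfolding t_def play_def by blast
    then have "t \<in> interp R' r \<longleftrightarrow> ?t i (map (g t) ws) \<in> interp R r" if "ar r = A i" for r
      using domR[of "map_option (g t) \<circ> t" r] ws(1) by (auto simp: R'_def tuple_map)
    then have "sat ar R' (rebind (bs i) [map (\<lambda>q. Var (snd q)) (qs i) [\<mapsto>] vs]) (\<rho> i) \<longleftrightarrow>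
      sat ar R (rebind (bs i) [map (\<lambda>q. Var (snd q)) (qs i) [\<mapsto>] map (g t) ws]) (\<rho> i)"
      by (intro boolean_combination_cong[OF \<rho>[OF i]]) (simp add: t_def tuple_def)
    then show "sat ar R' [map (\<lambda>q. Var (snd q)) (qs i) [\<mapsto>] vs] (foldr bind (bs i) (\<rho> i))"
      using \<sigma>(2)[OF i ws(2)] by (simp add: sat_foldr_bind)
  qed
  moreover have "finite_structure R'" "is_structure ar R'"
    using U \<open>U \<noteq> {}\<close> by (auto simp: finite_structure_def is_structure_def R'_def)
  ultimately show ?thesis
    by blast
qed

section \<open>Reduction to finitely many blocks\<close>

definition is_block :: "('r \<Rightarrow> 'a set) \<Rightarrow> ('a, 'r, 'v) form \<Rightarrow> bool" where
  "is_block ar \<psi> \<longleftrightarrow> (\<exists>A qs bs \<rho>. boolean_combination ar A \<rho> \<and>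
     foldr quantify qs (foldr bind bs \<rho>) = \<psi>)"

text \<open>Blocks are combined only by the monotone connectives: keep both sides of a true
  conjunction and one true side of a disjunction. The blocks kept hold in \<open>R\<close>, and
  together they imply \<open>\<phi>\<close> in structures over another element type.\<close>

lemma OBFOL_blocks:
  fixes R :: "('a, 'r, 'd) struct"
  assumes "OBFOL ar \<phi>" and "sat ar R \<chi> \<phi>"
  shows "\<exists>\<Psi>. finite \<Psi> \<and> \<Psi> \<noteq> {} \<and> (\<forall>\<psi>\<in>\<Psi>. is_block ar \<psi> \<and> sat ar R \<chi> \<psi>) \<and>
    (\<forall>(R' :: ('a, 'r, 'e) struct) \<chi>'. (\<forall>\<psi>\<in>\<Psi>. sat ar R' \<chi>' \<psi>) \<longrightarrow> sat ar R' \<chi>' \<phi>)"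
  using assms
proof (induction rule: OBFOL.induct)
  case (1 qs bs \<rho>)
  then show ?case
    by (intro exI[of _ "{foldr quantify qs (foldr bind bs \<rho>)}"])
      (auto simp: is_block_def derived_relation_def)
next
  case (2 \<phi> \<psi>)
  then obtain \<Phi> \<Psi> where
    "finite \<Phi> \<and> \<Phi> \<noteq> {} \<and> (\<forall>\<psi>\<in>\<Phi>. is_block ar \<psi> \<and> sat ar R \<chi> \<psi>) \<and>
      (\<forall>(R' :: ('a, 'r, 'e) struct) \<chi>'. (\<forall>\<psi>\<in>\<Phi>. sat ar R' \<chi>' \<psi>) \<longrightarrow> sat ar R' \<chi>' \<phi>)"
    "finite \<Psi> \<and> \<Psi> \<noteq> {} \<and> (\<forall>\<psi>\<in>\<Psi>. is_block ar \<psi> \<and> sat ar R \<chi> \<psi>) \<and>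
      (\<forall>(R' :: ('a, 'r, 'e) struct) \<chi>'. (\<forall>\<psi>\<in>\<Psi>. sat ar R' \<chi>' \<psi>) \<longrightarrow> sat ar R' \<chi>' \<psi>)"
    by auto
  then show ?case
    by (intro exI[of _ "\<Phi> \<union> \<Psi>"]) auto
next
  case (3 \<phi> \<psi>)
  have disj: "sat ar R \<chi> \<phi> \<or> sat ar R \<chi> \<psi>"
    using 3 by simp
  show ?case
    using disj
  proof
    assume "sat ar R \<chi> \<phi>"
    from "3.IH"(1)[OF this] show ?thesis
      by (elim ex_forward conjE) simp
  next
    assume "sat ar R \<chi> \<psi>"
    from "3.IH"(2)[OF this] show ?thesis
      by (elim ex_forward conjE) simp
  qed
qed

theorem mainTheorem10:
  fixes ar :: "'r::finite \<Rightarrow> 'a::finite set"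
    and \<phi> :: "('a, 'r, 'v) form"
  assumes "is_signature ar"
    and "OBFOL ar \<phi>"
    and "sentence ar \<phi>"
    and "satisfiable TYPE('d) ar \<phi>"
  shows "\<exists>R :: ('a, 'r, nat) struct. finite_structure R \<and> is_model ar R \<phi>"
proof -
  obtain R :: "('a, 'r, 'd) struct" where R: "is_structure ar R" "sat ar R Map.empty \<phi>"
    using assms(4) by (auto simp: satisfiable_def is_model_def)
  obtain \<Psi> :: "('a, 'r, 'v) form set" where \<Psi>: "finite \<Psi>" "\<Psi> \<noteq> {}"
    "\<And>\<psi>. \<psi> \<in> \<Psi> \<Longrightarrow> is_block ar \<psi>" "\<And>\<psi>. \<psi> \<in> \<Psi> \<Longrightarrow> sat ar R Map.empty \<psi>"
    "\<And>R' :: ('a, 'r, nat) struct. (\<forall>\<psi>\<in>\<Psi>. sat ar R' Map.empty \<psi>) \<Longrightarrow> sat ar R' Map.empty \<phi>"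
    using OBFOL_blocks[OF assms(2) R(2), where ?'e = nat] by (elim exE conjE) (rule that; blast)
  from \<Psi>(3) obtain A qs bs \<rho> where block: "\<And>\<psi>. \<psi> \<in> \<Psi> \<Longrightarrow>
    boolean_combination ar (A \<psi>) (\<rho> \<psi>) \<and> foldr quantify (qs \<psi>) (foldr bind (bs \<psi>) (\<rho> \<psi>)) = \<psi>"
    unfolding is_block_def by metis
  have "sat ar R Map.empty (foldr quantify (qs \<psi>) (foldr bind (bs \<psi>) (\<rho> \<psi>)))" if "\<psi> \<in> \<Psi>" for \<psi>
    using \<Psi>(4)[OF that] block[OF that] by simp
  \<comment> \<open>The set of blocks serves as its own index set.\<close>
  then obtain R' :: "('a, 'r, nat) struct" where R': "finite_structure R'" "is_structure ar R'"
    "\<And>\<psi>. \<psi> \<in> \<Psi> \<Longrightarrow> sat ar R' Map.empty (foldr quantify (qs \<psi>) (foldr bind (bs \<psi>) (\<rho> \<psi>)))"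
    using finite_model_of_blocks[OF \<Psi>(1,2) _ R(1), of A \<rho> qs bs] block by blast
  have "sat ar R' Map.empty \<psi>" if "\<psi> \<in> \<Psi>" for \<psi>
    using R'(3)[OF that] block[OF that] by simp
  then have "sat ar R' Map.empty \<phi>"
    using \<Psi>(5) by blast
  then show ?thesis
    using R'(1,2) by (auto simp: is_model_def)
qed

end
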